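(* Let $d>2$ be a prime number, let $\mathcal{H}_d=\mathbb{C}^d$ with computational basis $\{|0\rangle,\dots,|d-1\rangle\}$, let $X\in M(d,\mathbb{C})$ be a unitary matrix with $X^d=\mathbb{I}_d$ and $\operatorname{Tr}(X^iX^{j\dagger})=0$ for all $i\neq j$ in $\{0,\dots,d-1\}$, and let $M_s=\operatorname{span}_{\mathbb{C}}\{X^0,X^1,\dots,X^{d-1}\}$. Then the monoid $(\mathcal{H}_d,\bullet,|0\rangle)$ is isomorphic to the monoid $(M_s,\cdot,\mathbb{I}_d)$; i.e., there exists a bijection $G:\mathcal{H}_d\to M_s$ such that for all $|\varphi\rangle,|\phi\rangle\in\mathcal{H}_d$, $$G(|\varphi\rangle\bullet|\phi\rangle)=G(|\varphi\rangle)\cdot G(|\phi\rangle).$$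
   Context: $M(d,\mathbb{C})$ is the space of $d\times d$ complex matrices, $\dagger$ is the conjugate transpose, $\cdot$ is matrix multiplication, and $\mathbb{I}_d$ is the identity matrix. The binary operation $\bullet$ on $\mathcal{H}_d$ is defined by $\left(\sum_{i=0}^{d-1}a_i|i\rangle\right)\bullet\left(\sum_{j=0}^{d-1}b_j|j\rangle\right)=\sum_{m=0}^{d-1}\alpha_m|m\rangle$, where $\alpha_m=\sum_{i,j:\,i\oplus j=m}a_ib_j$ and $\oplus$ is addition modulo $d$; with this operation $\mathcal{H}_d$ is a monoid with identity $|0\rangle$. *)

theory Defs
  imports
    "HOL-Computational_Algebra.Primes"
    "Jordan_Normal_Form.VS_Connect"
    "Jordan_Normal_Form.Schur_Decomposition"
begin

text \<open>The space \<open>\<complex>\<^sup>d\<close> is \<^term>\<open>carrier_vec d\<close>, with computational basis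
  \<^term>\<open>unit_vec d i\<close> for \<open>i < d\<close>; the space of complex \<open>d\<close> by \<open>d\<close> matrices is
  \<^term>\<open>carrier_mat d d\<close>; the conjugate transpose is \<^const>\<open>mat_adjoint\<close>.\<close>

definition mat_trace :: "'a :: comm_monoid_add mat \<Rightarrow> 'a" where
  "mat_trace A = (\<Sum>i<dim_row A. A $$ (i, i))"

definition unitary_mat :: "nat \<Rightarrow> complex mat \<Rightarrow> bool" where
  "unitary_mat d U \<longleftrightarrow> U \<in> carrier_mat d d \<and>
     U * mat_adjoint U = 1\<^sub>m d \<and> mat_adjoint U * U = 1\<^sub>m d"

definition cyclic_mult :: "nat \<Rightarrow> complex vec \<Rightarrow> complex vec \<Rightarrow> complex vec" where
  "cyclic_mult d a b =
     vec d (\<lambda>m. \<Sum>(i, j) \<in> {(i, j). i < d \<and> j < d \<and> (i + j) mod d = m}. a $ i * b $ j)"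

definition state_monoid :: "nat \<Rightarrow> complex vec monoid" where
  "state_monoid d = \<lparr>carrier = carrier_vec d, monoid.mult = cyclic_mult d, one = unit_vec d 0\<rparr>"

definition power_span :: "nat \<Rightarrow> complex mat \<Rightarrow> complex mat set" where
  "power_span d X =
     LinearCombinations.module.span class_ring (module_mat TYPE(complex) d d) {X ^\<^sub>m i | i. i < d}"

definition power_span_monoid :: "nat \<Rightarrow> complex mat \<Rightarrow> complex mat monoid" where
  "power_span_monoid d X = \<lparr>carrier = power_span d X, monoid.mult = (*), one = 1\<^sub>m d\<rparr>"

end

theory Submission
  imports Defs
begin

text \<open>The isomorphism sends \<open>a\<close> to \<open>\<Sum>\<^sub>i a\<^sub>i X\<^sup>i\<close>. It is multiplicative because \<open>X\<^sup>d = \<one>\<close> makes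
  exponents add modulo \<open>d\<close>, and injective because the powers of \<open>X\<close> are orthogonal for the
  trace form, so that \<open>a\<^sub>j\<close> is \<open>1/d\<close> times the trace of \<open>(\<Sum>\<^sub>i a\<^sub>i X\<^sup>i) (X\<^sup>j)\<^sup>\<dagger>\<close>. The monoid laws for
  \<open>\<bullet>\<close> are then pulled back from matrix multiplication.\<close>

section \<open>Adjoints and unitary matrices\<close>

lemma mat_adjoint_carrier:
  "A \<in> carrier_mat n m \<Longrightarrow> mat_adjoint A \<in> carrier_mat m n"
  by (auto simp: mat_adjoint_def)

lemma index_mat_adjoint:
  fixes A :: "complex mat"
  assumes "A \<in> carrier_mat n m" "i < m" "j < n"
  shows "mat_adjoint A $$ (i, j) = cnj (A $$ (j, i))"
  using assms by (auto simp: mat_adjoint_def mat_of_rows_def)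

lemma mat_adjoint_one: "mat_adjoint (1\<^sub>m n :: complex mat) = 1\<^sub>m n"
proof -
  have "mat_adjoint (1\<^sub>m n :: complex mat) \<in> carrier_mat n n"
    by (rule mat_adjoint_carrier) simp
  then show ?thesis
    by (intro eq_matI) (auto simp: index_mat_adjoint[of _ n n])
qed

lemma mat_adjoint_mult:
  fixes A B :: "complex mat"
  assumes A: "A \<in> carrier_mat n m" and B: "B \<in> carrier_mat m p"
  shows "mat_adjoint (A * B) = mat_adjoint B * mat_adjoint A"
proof -
  have AB: "A * B \<in> carrier_mat n p"
    using A B by simp
  show ?thesis
    using A B mat_adjoint_carrier[OF A] mat_adjoint_carrier[OF B] mat_adjoint_carrier[OF AB]
    by (intro eq_matI)
      (auto simp: index_mat_adjoint[OF AB] scalar_prod_def index_mat_adjoint[OF A]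
        index_mat_adjoint[OF B] mult.commute intro!: sum.cong)
qed

lemma unitary_mat_mult:
  assumes "unitary_mat d U" "unitary_mat d V"
  shows "unitary_mat d (U * V)"
proof -
  have c: "U \<in> carrier_mat d d" "V \<in> carrier_mat d d"
    and u: "U * mat_adjoint U = 1\<^sub>m d" "mat_adjoint U * U = 1\<^sub>m d"
    and v: "V * mat_adjoint V = 1\<^sub>m d" "mat_adjoint V * V = 1\<^sub>m d"
    using assms by (auto simp: unitary_mat_def)
  note ca = mat_adjoint_carrier[OF c(1)] mat_adjoint_carrier[OF c(2)]
  \<comment> \<open>Reassociation brings \<open>V\<close> next to its adjoint, so the inner pair
    cancels first and the outer pair after it; the next step does the same on the other
    side.\<close>
  have "U * V * (mat_adjoint V * mat_adjoint U) = U * (V * mat_adjoint V) * mat_adjoint U"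
    using c ca by (simp add: assoc_mult_mat[where n\<^sub>2 = d and n\<^sub>3 = d and n\<^sub>4 = d])
  moreover have "mat_adjoint V * mat_adjoint U * (U * V) = mat_adjoint V * (mat_adjoint U * U) * V"
    using c ca by (simp add: assoc_mult_mat[where n\<^sub>2 = d and n\<^sub>3 = d and n\<^sub>4 = d])
  ultimately show ?thesis
    using c ca u v by (simp add: unitary_mat_def mat_adjoint_mult)
qed

text \<open>Supplies the diagonal case of the trace relations: unitarity of the \<open>j\<close>-th
  power makes its product with its own adjoint the identity, of trace \<open>d\<close>.\<close>

lemma unitary_mat_pow:
  assumes "unitary_mat d U"
  shows "unitary_mat d (U ^\<^sub>m k)"
proof (induction k)
  case 0
  then show ?case
    using assms by (auto simp: unitary_mat_def mat_adjoint_one)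
next
  case (Suc k)
  then show ?case
    using assms by (simp add: unitary_mat_mult)
qed

section \<open>Powers of a matrix of finite order\<close>

lemma pow_mat_add:
  fixes A :: "'a :: semiring_1 mat"
  assumes A: "A \<in> carrier_mat n n"
  shows "A ^\<^sub>m (i + j) = A ^\<^sub>m i * A ^\<^sub>m j"
proof (induction j)
  case 0
  then show ?case
    using A right_mult_one_mat[OF pow_carrier_mat[OF A]] by auto
next
  case (Suc j)
  then show ?case
    using A by (simp add: assoc_mult_mat[OF pow_carrier_mat[OF A] pow_carrier_mat[OF A] A])
qed

lemma pow_mat_mod:
  fixes A :: "'a :: semiring_1 mat"
  assumes A: "A \<in> carrier_mat n n" and one: "A ^\<^sub>m d = 1\<^sub>m n"
  shows "A ^\<^sub>m (i mod d) = A ^\<^sub>m i"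
proof -
  have "A ^\<^sub>m (k * d) = 1\<^sub>m n" for k
  proof (induction k)
    case 0
    then show ?case using A by auto
  next
    case (Suc k)
    then show ?case using A one by (simp add: pow_mat_add)
  qed
  moreover have "A ^\<^sub>m i = A ^\<^sub>m (i div d * d + i mod d)"
    by simp
  ultimately show ?thesis
    using A by (simp only: pow_mat_add[OF A] left_mult_one_mat[OF pow_carrier_mat[OF A]])
qed

section \<open>Linear combinations of the powers of \<open>X\<close>\<close>

text \<open>Defined entrywise, so that identities reduce to ordinary complex sums;
  \<open>power_comb_image\<close> makes the link to the span in the matrix module.\<close>

definition power_comb :: "nat \<Rightarrow> complex mat \<Rightarrow> complex vec \<Rightarrow> complex mat" where
  "power_comb d X a = mat d d (\<lambda>rc. \<Sum>i<d. a $ i * (X ^\<^sub>m i) $$ rc)"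

lemma power_comb_carrier: "power_comb d X a \<in> carrier_mat d d"
  by (simp add: power_comb_def)

text \<open>Places the generators of the span in the image of \<open>power_comb\<close> and, for
  \<open>i = 0\<close>, gives preservation of the identity.\<close>

lemma power_comb_unit_vec:
  assumes "X \<in> carrier_mat d d" "i < d"
  shows "power_comb d X (unit_vec d i) = X ^\<^sub>m i"
  using assms
  by (intro eq_matI) (auto simp: power_comb_def unit_vec_def if_distrib[of "\<lambda>x. x * _"] cong: if_cong)

text \<open>The image lies in the span because a combination can be built up one term at a time.
  Conversely, the image is a submodule that contains the generators, and the span is the least such
  submodule.\<close>

lemma power_comb_image:
  assumes X: "X \<in> carrier_mat d d"
  shows "power_comb d X ` carrier_vec d = power_span d X"
proof -
  interpret M: matrix_vs d d "TYPE(complex)" .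
  let ?P = "{X ^\<^sub>m i | i. i < d}"
  have P: "?P \<subseteq> carrier_mat d d"
    using X by auto
  have "power_comb d X a \<in> power_span d X" for a
  proof -
    \<comment> \<open>Truncation to the first \<open>k\<close> terms, for an induction on
      \<open>k\<close> that ends with the full combination at \<open>k = d\<close>.\<close>
    let ?S = "\<lambda>k. mat d d (\<lambda>rc. \<Sum>i<k. a $ i * (X ^\<^sub>m i) $$ rc)"
    have sub: "submodule class_ring (M.span ?P) M.V"
      by (rule M.span_is_submodule[OF P])
    have "k \<le> d \<Longrightarrow> ?S k \<in> M.span ?P" for k
    proof (induction k)
      case 0
      have "?S 0 = 0\<^sub>m d d"
        by (intro eq_matI) auto
      then show ?case
        using submodule.zero_closed[OF sub] by (simp add: module_mat_simps)
    next
      case (Suc k)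
      have "X ^\<^sub>m k \<in> M.span ?P"
        by (rule subsetD[OF M.in_own_span[OF P]]) (use Suc.prems in auto)
      then have "?S k + a $ k \<cdot>\<^sub>m X ^\<^sub>m k \<in> M.span ?P"
        using submodule.m_closed[OF sub] submodule.smult_closed[OF sub] Suc
        by (simp add: module_mat_simps)
      moreover have "?S (Suc k) = ?S k + a $ k \<cdot>\<^sub>m X ^\<^sub>m k"
        using X by (intro eq_matI) (auto split: if_splits)
      ultimately show ?case
        by simp
    qed
    from this[of d] show ?thesis
      by (simp add: power_comb_def power_span_def)
  qed
  moreover have "M.span ?P \<subseteq> power_comb d X ` carrier_vec d"
  proof (rule M.span_is_subset)
    show "?P \<subseteq> power_comb d X ` carrier_vec d"
    proof
      fix A assume "A \<in> ?P"
      then obtain i where "i < d" "A = X ^\<^sub>m i" by auto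
      then show "A \<in> power_comb d X ` carrier_vec d"
        using power_comb_unit_vec[OF X] by (intro image_eqI[of _ _ "unit_vec d i"]) auto
    qed
    show "submodule class_ring (power_comb d X ` carrier_vec d) M.V"
    proof (unfold_locales, unfold module_mat_simps class_ring_simps)
      show "power_comb d X ` carrier_vec d \<subseteq> carrier_mat d d"
        by (auto simp: power_comb_carrier)
      have "power_comb d X (0\<^sub>v d) = 0\<^sub>m d d"
        by (intro eq_matI) (auto simp: power_comb_def)
      then show "0\<^sub>m d d \<in> power_comb d X ` carrier_vec d"
        by (intro image_eqI[of _ _ "0\<^sub>v d"]) auto
    next
      fix v w
      assume "v \<in> power_comb d X ` carrier_vec d" "w \<in> power_comb d X ` carrier_vec d"
      then obtain a b where ab: "a \<in> carrier_vec d" "b \<in> carrier_vec d"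
        and vw: "v = power_comb d X a" "w = power_comb d X b" by auto
      have "v + w = power_comb d X (a + b)"
        using ab vw
        by (intro eq_matI) (auto simp: power_comb_def algebra_simps sum.distrib)
      then show "v + w \<in> power_comb d X ` carrier_vec d"
        using ab by auto
    next
      fix c v
      assume "v \<in> power_comb d X ` carrier_vec d"
      then obtain a where a: "a \<in> carrier_vec d" and v: "v = power_comb d X a" by auto
      have "c \<cdot>\<^sub>m v = power_comb d X (c \<cdot>\<^sub>v a)"
        using a v by (intro eq_matI) (auto simp: power_comb_def algebra_simps sum_distrib_left)
      then show "c \<cdot>\<^sub>m v \<in> power_comb d X ` carrier_vec d"
        using a by auto
    qed
  qed
  ultimately show ?thesis
    by (auto simp: power_span_def)
qed

text \<open>Both sides equal the sum of \<open>a $ i * b $ j\<close> times the power of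
  \<open>X\<close> with exponent \<open>i + j\<close>: on the left the exponent is reduced modulo
  \<open>d\<close>, which changes nothing as \<open>X\<close> has order dividing
  \<open>d\<close>.\<close>

lemma power_comb_cyclic_mult:
  assumes X: "X \<in> carrier_mat d d" and one: "X ^\<^sub>m d = 1\<^sub>m d"
  shows "power_comb d X (cyclic_mult d a b) = power_comb d X a * power_comb d X b"
proof (rule eq_matI)
  fix r c
  assume "r < dim_row (power_comb d X a * power_comb d X b)"
    "c < dim_col (power_comb d X a * power_comb d X b)"
  then have rc: "r < d" "c < d"
    by (auto simp: power_comb_def)
  let ?I = "{..<d} \<times> {..<d}"
  let ?f = "\<lambda>(i, j). a $ i * b $ j * (X ^\<^sub>m ((i + j) mod d)) $$ (r, c)"
  have pow: "(X ^\<^sub>m ((i + j) mod d)) $$ (r, c) = (\<Sum>k<d. (X ^\<^sub>m i) $$ (r, k) * (X ^\<^sub>m j) $$ (k, c))"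
    for i j
    using X rc by (simp add: pow_mat_mod[OF X one] pow_mat_add scalar_prod_def lessThan_atLeast0)
  have "power_comb d X (cyclic_mult d a b) $$ (r, c) =
      (\<Sum>m<d. \<Sum>p\<in>{p \<in> ?I. (fst p + snd p) mod d = m}. ?f p)"
    using rc
    by (auto simp: power_comb_def cyclic_mult_def sum_distrib_right intro!: sum.cong)
  \<comment> \<open>The inner sums run over the fibres of \<open>(i + j) mod d\<close>, which
    partition the index square.\<close>
  also have "\<dots> = sum ?f ?I"
    by (rule sum.group) auto
  also have "\<dots> = (\<Sum>i<d. \<Sum>j<d. \<Sum>k<d. a $ i * (X ^\<^sub>m i) $$ (r, k) * (b $ j * (X ^\<^sub>m j) $$ (k, c)))"
    by (simp add: sum.cartesian_product[symmetric] pow sum_distrib_left mult_ac)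
  \<comment> \<open>Two exchanges move \<open>k\<close>, the summation index of the matrix product,
    to the outside.\<close>
  also have "\<dots> = (\<Sum>i<d. \<Sum>k<d. \<Sum>j<d. a $ i * (X ^\<^sub>m i) $$ (r, k) * (b $ j * (X ^\<^sub>m j) $$ (k, c)))"
    by (intro sum.cong refl sum.swap)
  also have "\<dots> = (\<Sum>k<d. \<Sum>i<d. \<Sum>j<d. a $ i * (X ^\<^sub>m i) $$ (r, k) * (b $ j * (X ^\<^sub>m j) $$ (k, c)))"
    by (rule sum.swap)
  also have "\<dots> = (power_comb d X a * power_comb d X b) $$ (r, c)"
    using rc by (simp add: power_comb_def scalar_prod_def sum_product lessThan_atLeast0)
  finally show "power_comb d X (cyclic_mult d a b) $$ (r, c) =
      (power_comb d X a * power_comb d X b) $$ (r, c)" .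
qed (simp_all add: power_comb_def)

section \<open>Recovering coefficients from the trace form\<close>

lemma mat_trace_power_comb_mult:
  assumes X: "X \<in> carrier_mat d d" and B: "B \<in> carrier_mat d d"
  shows "mat_trace (power_comb d X a * B) = (\<Sum>i<d. a $ i * mat_trace (X ^\<^sub>m i * B))"
proof -
  have "mat_trace (power_comb d X a * B) =
      (\<Sum>r<d. \<Sum>k<d. \<Sum>i<d. a $ i * ((X ^\<^sub>m i) $$ (r, k) * B $$ (k, r)))"
    using B
    by (simp add: mat_trace_def power_comb_def scalar_prod_def lessThan_atLeast0
        sum_distrib_right mult.assoc)
  also have "\<dots> = (\<Sum>r<d. \<Sum>i<d. \<Sum>k<d. a $ i * ((X ^\<^sub>m i) $$ (r, k) * B $$ (k, r)))"
    by (intro sum.cong refl sum.swap)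
  also have "\<dots> = (\<Sum>i<d. \<Sum>r<d. \<Sum>k<d. a $ i * ((X ^\<^sub>m i) $$ (r, k) * B $$ (k, r)))"
    by (rule sum.swap)
  also have "\<dots> = (\<Sum>i<d. a $ i * mat_trace (X ^\<^sub>m i * B))"
    using X B
    by (simp add: mat_trace_def scalar_prod_def lessThan_atLeast0 sum_distrib_left)
  finally show ?thesis .
qed

lemma inj_on_power_comb:
  assumes U: "unitary_mat d X"
    and orth: "\<forall>i<d. \<forall>j<d. i \<noteq> j \<longrightarrow> mat_trace (X ^\<^sub>m i * mat_adjoint (X ^\<^sub>m j)) = 0"
  shows "inj_on (power_comb d X) (carrier_vec d)"
proof (rule inj_onI)
  have X: "X \<in> carrier_mat d d"
    using U by (simp add: unitary_mat_def)
  have coeff: "mat_trace (power_comb d X a * mat_adjoint (X ^\<^sub>m j)) = a $ j * of_nat d"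
    if j: "j < d" for a j
  proof -
    \<comment> \<open>Off the diagonal this is the orthogonality assumption; on it, unitarity of the
      power leaves the trace of the identity.\<close>
    have "mat_trace (X ^\<^sub>m i * mat_adjoint (X ^\<^sub>m j)) = (if i = j then of_nat d else 0)"
      if "i < d" for i
      using that j orth unitary_mat_pow[OF U, of j] X by (auto simp: unitary_mat_def mat_trace_def)
    then show ?thesis
      using j mat_trace_power_comb_mult[OF X mat_adjoint_carrier[OF pow_carrier_mat[OF X]]]
      by (simp add: if_distrib[of "\<lambda>x. _ * x"] cong: if_cong)
  qed
  fix a b
  assume "a \<in> carrier_vec d" "b \<in> carrier_vec d" and eq: "power_comb d X a = power_comb d X b"
  \<comment> \<open>The common factor \<open>of_nat d\<close> cancels, since \<open>j < d\<close>
    forces \<open>d\<close> to be nonzero.\<close>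
  moreover have "a $ j = b $ j" if "j < d" for j
    using coeff[OF that, of a] coeff[OF that, of b] eq that by simp
  ultimately show "a = b"
    by (intro eq_vecI) auto
qed

theorem lemma6:
  fixes d :: nat and X :: "complex mat"
  assumes "prime d" and "d > 2"
    and "unitary_mat d X"
    and "X ^\<^sub>m d = 1\<^sub>m d"
    and "\<forall>i<d. \<forall>j<d. i \<noteq> j \<longrightarrow> mat_trace (X ^\<^sub>m i * mat_adjoint (X ^\<^sub>m j)) = 0"
  shows "monoid (state_monoid d) \<and> monoid (power_span_monoid d X) \<and>
    (\<exists>G. G \<in> iso (state_monoid d) (power_span_monoid d X))"
proof -
  have X: "X \<in> carrier_mat d d"
    using assms(3) by (simp add: unitary_mat_def)
  let ?G = "power_comb d X"
  note img = power_comb_image[OF X]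
  note hom = power_comb_cyclic_mult[OF X assms(4)]
  note inj = inj_on_power_comb[OF assms(3,5)]
  have closed: "cyclic_mult d a b \<in> carrier_vec d" for a b
    by (simp add: cyclic_mult_def)
  \<comment> \<open>The index 0 has to lie below \<open>d\<close>, which follows from
    \<open>d > 2\<close>.\<close>
  have G_one: "?G (unit_vec d 0) = 1\<^sub>m d"
    using power_comb_unit_vec[OF X, of 0] X assms(2) by simp
  have sub: "power_span d X \<subseteq> carrier_mat d d"
    unfolding img[symmetric] by (auto simp: power_comb_carrier)
  have "monoid (power_span_monoid d X)"
  proof (rule monoidI; simp add: power_span_monoid_def)
    fix A B assume "A \<in> power_span d X" "B \<in> power_span d X"
    \<comment> \<open>A product of two images is the image of the cyclic product, hence again in the
      span.\<close>
    then show "A * B \<in> power_span d X"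
      unfolding img[symmetric] using closed by (auto simp: hom[symmetric])
  next
    show "1\<^sub>m d \<in> power_span d X"
      unfolding img[symmetric] G_one[symmetric] by simp
  qed (use sub in \<open>auto intro!: assoc_mult_mat\<close>)
  moreover have "monoid (state_monoid d)"
  proof (rule monoidI; simp add: state_monoid_def closed)
    fix a b c :: "complex vec"
    \<comment> \<open>Both bracketings have the same image, by associativity of matrix
      multiplication. As \<open>cyclic_mult\<close> always yields a vector of dimension
      \<open>d\<close>, injectivity on \<open>carrier_vec d\<close> then identifies them; the unit
      laws follow in the same way.\<close>
    have "?G (cyclic_mult d (cyclic_mult d a b) c) = ?G (cyclic_mult d a (cyclic_mult d b c))"
      unfolding hom by (rule assoc_mult_mat) (rule power_comb_carrier)+
    then show "cyclic_mult d (cyclic_mult d a b) c = cyclic_mult d a (cyclic_mult d b c)"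
      using inj closed by (auto dest: inj_onD)
  next
    fix a :: "complex vec"
    assume a: "a \<in> carrier_vec d"
    have "?G (cyclic_mult d (unit_vec d 0) a) = ?G a" "?G (cyclic_mult d a (unit_vec d 0)) = ?G a"
      using power_comb_carrier[of d X a] by (simp_all add: hom G_one)
    then show "cyclic_mult d (unit_vec d 0) a = a" "cyclic_mult d a (unit_vec d 0) = a"
      using inj closed a by (auto dest: inj_onD)
  qed
  moreover have "?G \<in> iso (state_monoid d) (power_span_monoid d X)"
    using img inj
    by (auto simp: iso_def hom_def bij_betw_def state_monoid_def power_span_monoid_def hom)
  ultimately show ?thesis
    by blast
qed

end
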